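(* Let $k\ge 1$, let $m_{1},\dots,m_{k},n_{1},\dots,n_{k}\ge 0$ be integers with $m_{1}-n_{1}=\dots=m_{k}-n_{k}=\delta\ge 0$, let $a_{1},\dots,a_{k}\in\mathbb{C}\setminus\{0\}$, and let $\varphi(z)=a_{1}z^{m_{1}}\bar{z}^{n_{1}}+\dots+a_{k}z^{m_{k}}\bar{z}^{n_{k}}$ on $\mathbb{D}$. If all the $a_{i}$, $1\le i\le k$, lie in the same quarter-plane (i.e. $\max_{1\le i,j\le k}|\arg(a_{i})-\arg(a_{j})|\le\frac{\pi}{2}$), then the Toeplitz operator $T_{\varphi}$ on the Bergman space $A^{2}(\mathbb{D})$ is hyponormal.
   Context: The differences of arguments are understood as angles between the corresponding complex numbers; thus the hypothesis means that there is a real $\theta_0$ such that every $a_i$ can be written as $|a_i|e^{i\theta_i}$ (with $i$ in the exponent the imaginary unit) with $\theta_0\le\theta_i\le\theta_0+\frac{\pi}{2}$. $\mathbb{D}$ is the open unit disc in $\mathbb{C}$. The Bergman space is $A^{2}(\mathbb{D})=\{f \text{ holomorphic on }\mathbb{D}:\int_{\mathbb{D}}|f(z)|^{2}\,dA(z)<\infty\}$, where $dA$ is area measure, regarded as a closed subspace of $L^{2}(\mathbb{D})$. For $\varphi\in L^{\infty}(\mathbb{D})$, the Toeplitz operator is $T_{\varphi}f=P(\varphi f)$ for $f\in A^{2}(\mathbb{D})$, where $P$ is the orthogonal projection from $L^{2}(\mathbb{D})$ onto $A^{2}(\mathbb{D})$. A bounded operator $T$ on a complex Hilbert space $H$ is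 hyponormal if $[T^{*},T]:=T^{*}T-TT^{*}\ge 0$, i.e. $\langle [T^{*},T]u,u\rangle\ge 0$ for all $u\in H$. *)

theory Defs
  imports "HOL-Complex_Analysis.Complex_Analysis"
begin

abbreviation disc_measure :: "complex measure" where
  "disc_measure \<equiv> lebesgue_on (ball 0 1)"

definition L2_inner :: "(complex \<Rightarrow> complex) \<Rightarrow> (complex \<Rightarrow> complex) \<Rightarrow> complex" where
  "L2_inner f g = (\<integral>z. f z * cnj (g z) \<partial>disc_measure)"

definition L2_norm :: "(complex \<Rightarrow> complex) \<Rightarrow> real" where
  "L2_norm f = sqrt (\<integral>z. (cmod (f z))\<^sup>2 \<partial>disc_measure)"

(* HOL functions are total, so a function on the unit disc is represented by its
   extension by 0. This makes equality in the Bergman space the equality of HOL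
   functions, and keeps the space closed under the pointwise vector operations. *)
definition bergman_space :: "(complex \<Rightarrow> complex) set" where
  "bergman_space =
     {f. f holomorphic_on ball 0 1
       \<and> integrable disc_measure (\<lambda>z. (cmod (f z))\<^sup>2)
       \<and> (\<forall>z. z \<notin> ball 0 1 \<longrightarrow> f z = 0)}"

(* Meaningful for g square-integrable on the disc: the unique h in the Bergman
   space such that g - h is orthogonal to it. *)
definition bergman_proj :: "(complex \<Rightarrow> complex) \<Rightarrow> (complex \<Rightarrow> complex)" where
  "bergman_proj g =
     (THE h. h \<in> bergman_space
        \<and> (\<forall>u\<in>bergman_space. L2_inner (\<lambda>z. g z - h z) u = 0))"

definition toeplitz :: "(complex \<Rightarrow> complex) \<Rightarrow> (complex \<Rightarrow> complex) \<Rightarrow> (complex \<Rightarrow> complex)" where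
  "toeplitz \<phi> f = bergman_proj (\<lambda>z. \<phi> z * f z)"

definition bounded_operator :: "((complex \<Rightarrow> complex) \<Rightarrow> (complex \<Rightarrow> complex)) \<Rightarrow> bool" where
  "bounded_operator T \<longleftrightarrow>
     (\<forall>f\<in>bergman_space. T f \<in> bergman_space)
   \<and> (\<forall>f\<in>bergman_space. \<forall>g\<in>bergman_space. T (\<lambda>z. f z + g z) = (\<lambda>z. T f z + T g z))
   \<and> (\<forall>c. \<forall>f\<in>bergman_space. T (\<lambda>z. c * f z) = (\<lambda>z. c * T f z))
   \<and> (\<exists>C. \<forall>f\<in>bergman_space. L2_norm (T f) \<le> C * L2_norm f)"

(* Meaningful for bounded T and v in the Bergman space, where the Riesz
   representation theorem gives existence and uniqueness. *)
definition adjoint_operator ::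
  "((complex \<Rightarrow> complex) \<Rightarrow> (complex \<Rightarrow> complex)) \<Rightarrow> (complex \<Rightarrow> complex) \<Rightarrow> (complex \<Rightarrow> complex)" where
  "adjoint_operator T v =
     (THE w. w \<in> bergman_space
        \<and> (\<forall>u\<in>bergman_space. L2_inner (T u) v = L2_inner u w))"

definition self_commutator ::
  "((complex \<Rightarrow> complex) \<Rightarrow> (complex \<Rightarrow> complex)) \<Rightarrow> (complex \<Rightarrow> complex) \<Rightarrow> (complex \<Rightarrow> complex)" where
  "self_commutator T u =
     (\<lambda>z. adjoint_operator T (T u) z - T (adjoint_operator T u) z)"

definition hyponormal :: "((complex \<Rightarrow> complex) \<Rightarrow> (complex \<Rightarrow> complex)) \<Rightarrow> bool" where
  "hyponormal T \<longleftrightarrow>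
     bounded_operator T
   \<and> (\<forall>u\<in>bergman_space. L2_inner (self_commutator T u) u \<in> \<real>\<^sub>\<ge>\<^sub>0)"

end

theory Submission
  imports Defs
begin

text \<open>
  All monomials of the symbol have the same difference \<open>m\<^sub>i - n\<^sub>i = \<delta>\<close>, so \<open>T\<^sub>\<phi>\<close> maps \<open>z\<^sup>j\<close> to
  \<open>w\<^sub>j z\<^bsup>j+\<delta>\<^esup>\<close> with \<open>w\<^sub>j = \<Sum>\<^sub>i a\<^sub>i (j+\<delta>+1)/(j+m\<^sub>i+1)\<close>: it is a weighted shift
  (\<open>toeplitz_weighted_shift\<close>). The self-commutator of a weighted shift is diagonal in the monomial basis, and
  its entries are nonnegative if the squared weights \<open>p\<^sub>j = \<bar>w\<^sub>j\<bar>\<^sup>2 (j+1)/(j+\<delta>+1)\<close> with respect to the normalised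
  monomials satisfy \<open>p\<^sub>j \<le> p\<^bsub>j+\<delta>\<^esub>\<close> (\<open>hyponormal_weighted_shift\<close>). Expanding the square,
  \<open>p\<^sub>j\<close> is the sum over \<open>i\<close> and \<open>l\<close> of the real part of \<open>a\<^sub>i cnj a\<^sub>l\<close> times
  \<open>(j+1)/(j+m\<^sub>i+1) \<cdot> (j+\<delta>+1)/(j+m\<^sub>l+1)\<close>.
  The real part is nonnegative because \<open>a\<^sub>i\<close> and \<open>a\<^sub>l\<close> lie in a common quarter-plane
  (\<open>Re_mult_cnj_nonneg\<close>), and both quotients are nondecreasing in \<open>j\<close> because \<open>m\<^sub>i \<ge> 0\<close> and
  \<open>m\<^sub>l \<ge> \<delta>\<close>. So every term of the sum is nondecreasing in \<open>j\<close>.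

  The analytic input is the identification of the Bergman space with a weighted sequence space, by
  Parseval's identity \<open>\<integral>\<bar>f\<bar>\<^sup>2 = \<pi> \<Sum>\<^sub>j \<bar>c\<^sub>j\<bar>\<^sup>2/(j+1)\<close> for the Taylor coefficients \<open>c\<close> of \<open>f\<close>
  (\<open>nn_integral_disc_cmod_sq\<close>). It rests on the orthogonality of the monomials, which follows from the
  invariance of area under rotations, and on the integrals of the even powers of \<open>\<bar>z\<bar>\<close>. Projection
  and adjoint are then not obtained from abstract Hilbert space theory but given explicitly by coefficients.
\<close>

section \<open>Area measure of the plane\<close>

text \<open>Integrals over \<open>\<complex>\<close> are computed below as iterated real integrals; this identifies the two Lebesgue measures.\<close>

lemma distr_Complex_lborel: "distr lborel borel (\<lambda>p. Complex (fst p) (snd p)) = lborel"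
proof (rule lborel_eqI [symmetric])
  have C: "(\<lambda>p. Complex (fst p) (snd p)) \<in> borel_measurable borel"
    by (intro borel_measurable_continuous_onI continuous_intros)
  fix l u :: complex
  assume le: "\<And>b. b \<in> Basis \<Longrightarrow> l \<bullet> b \<le> u \<bullet> b"
  have "(\<lambda>p. Complex (fst p) (snd p)) -` box l u = box (Re l, Im l) (Re u, Im u)"
    by (auto simp: mem_box Basis_complex_def Basis_prod_def)
  moreover have "Re l \<le> Re u" "Im l \<le> Im u"
    using le [of 1] le [of \<i>] by (auto simp: Basis_complex_def)
  moreover have "emeasure lborel (box (a, b) (c, d)) = ennreal ((c - a) * (d - b))"
    if "a \<le> c" "b \<le> d" for a b c d :: real
    using that by (simp add: emeasure_lborel_box_eq Basis_prod_def inner_prod_def)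
  ultimately show "emeasure (distr lborel borel (\<lambda>p. Complex (fst p) (snd p))) (box l u)
      = (\<Prod>b\<in>Basis. (u - l) \<bullet> b)"
    using C by (simp add: emeasure_distr Basis_complex_def)
qed auto

lemma nn_integral_complex_Fubini:
  assumes [measurable]: "f \<in> borel_measurable (borel :: complex measure)"
  shows "(\<integral>\<^sup>+z. f z \<partial>lborel) = (\<integral>\<^sup>+x. \<integral>\<^sup>+y. f (Complex x y) \<partial>lborel \<partial>lborel)"
    and "(\<integral>\<^sup>+z. f z \<partial>lborel) = (\<integral>\<^sup>+y. \<integral>\<^sup>+x. f (Complex x y) \<partial>lborel \<partial>lborel)"
proof -
  have [measurable]: "(\<lambda>p. Complex (fst p) (snd p)) \<in> borel_measurable borel"
    by (intro borel_measurable_continuous_onI continuous_intros)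
  have *: "(\<integral>\<^sup>+z. f z \<partial>lborel) = (\<integral>\<^sup>+p. f (Complex (fst p) (snd p)) \<partial>(lborel \<Otimes>\<^sub>M lborel))"
    by (subst distr_Complex_lborel [symmetric], subst nn_integral_distr) (auto simp: lborel_prod)
  show "(\<integral>\<^sup>+z. f z \<partial>lborel) = (\<integral>\<^sup>+x. \<integral>\<^sup>+y. f (Complex x y) \<partial>lborel \<partial>lborel)"
    unfolding * by (subst lborel.nn_integral_fst [symmetric]) (auto simp: lborel_prod)
  show "(\<integral>\<^sup>+z. f z \<partial>lborel) = (\<integral>\<^sup>+y. \<integral>\<^sup>+x. f (Complex x y) \<partial>lborel \<partial>lborel)"
    unfolding * by (subst lborel_pair.nn_integral_snd [symmetric]) (auto simp: lborel_prod case_prod_beta')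
qed

text \<open>A shear translates each line of one of the two coordinate directions along itself, so Fubini reduces
  the invariance to the translation invariance of the line.\<close>

lemma nn_integral_complex_shear:
  assumes [measurable]: "f \<in> borel_measurable (borel :: complex measure)"
  shows "(\<integral>\<^sup>+z. f (Complex (Re z + t * Im z) (Im z)) \<partial>lborel) = (\<integral>\<^sup>+z. f z \<partial>lborel)"
    and "(\<integral>\<^sup>+z. f (Complex (Re z) (Im z + t * Re z)) \<partial>lborel) = (\<integral>\<^sup>+z. f z \<partial>lborel)"
proof -
  have C [measurable]: "(\<lambda>x. Complex x b) \<in> borel_measurable borel"
    "(\<lambda>x. Complex b x) \<in> borel_measurable borel" for b
    by (intro borel_measurable_continuous_onI continuous_intros)+
  have [measurable]: "(\<lambda>z. Complex (Re z + t * Im z) (Im z)) \<in> borel_measurable borel"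
    "(\<lambda>z. Complex (Re z) (Im z + t * Re z)) \<in> borel_measurable borel"
    by (intro borel_measurable_continuous_onI continuous_intros)+
  have tr: "(\<integral>\<^sup>+x. g (x + c) \<partial>lborel) = (\<integral>\<^sup>+x. g x \<partial>lborel)"
    if [measurable]: "g \<in> borel_measurable (borel :: real measure)" for c and g :: "real \<Rightarrow> ennreal"
    using nn_integral_real_affine [of g 1 c] by (simp add: add.commute)
  show "(\<integral>\<^sup>+z. f (Complex (Re z + t * Im z) (Im z)) \<partial>lborel) = (\<integral>\<^sup>+z. f z \<partial>lborel)"
    by (subst (1 2) nn_integral_complex_Fubini(2)) (auto intro!: nn_integral_cong tr)
  show "(\<integral>\<^sup>+z. f (Complex (Re z) (Im z + t * Re z)) \<partial>lborel) = (\<integral>\<^sup>+z. f z \<partial>lborel)"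
    by (subst (1 2) nn_integral_complex_Fubini(1)) (auto intro!: nn_integral_cong tr)
qed

text \<open>A rotation by a non-real number of modulus one is a product of three shears. The rotations by \<open>\<plusminus>1\<close>
  are composed of two such rotations.\<close>

lemma nn_integral_complex_rotate:
  assumes f: "f \<in> borel_measurable (borel :: complex measure)" and \<omega>: "cmod \<omega> = 1"
  shows "(\<integral>\<^sup>+z. f (\<omega> * z) \<partial>lborel) = (\<integral>\<^sup>+z. f z \<partial>lborel)"
proof -
  have rot: "(\<integral>\<^sup>+z. f (\<omega> * z) \<partial>lborel) = (\<integral>\<^sup>+z. f z \<partial>lborel)"
    if "cmod \<omega> = 1" "Im \<omega> \<noteq> 0" and [measurable]: "f \<in> borel_measurable borel"
    for \<omega> and f :: "complex \<Rightarrow> ennreal"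
  proof -
    define a b where "a = Re \<omega>" "b = Im \<omega>"
    define p where "p = (a - 1) / b"
    have ab: "a\<^sup>2 + b\<^sup>2 = 1" "b \<noteq> 0"
      using that cmod_power2 [of \<omega>] by (auto simp: a_b_def)
    have pb: "p * b = a - 1" using ab by (simp add: p_def)
    have pa: "p * (a + 1) = - b" using ab by (simp add: p_def field_simps power2_eq_square)
    \<comment> \<open>The factorisation of the rotation matrix of \<open>a + b \<i>\<close> into an upper, a lower and an upper
      unitriangular matrix.\<close>
    define S1 S2 where "S1 = (\<lambda>z. Complex (Re z + p * Im z) (Im z))"
      and "S2 = (\<lambda>z. Complex (Re z) (Im z + b * Re z))"
    have [measurable]: "S1 \<in> borel_measurable borel" "S2 \<in> borel_measurable borel"
      unfolding S1_def S2_def by (intro borel_measurable_continuous_onI continuous_intros)+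
    have m1: "(\<lambda>z. f (S1 (S2 z))) \<in> borel_measurable borel"
      and m2: "(\<lambda>z. f (S1 z)) \<in> borel_measurable borel" by measurable
    have "S1 (S2 (S1 z)) = \<omega> * z" for z
    proof -
      have "x + p * y + p * (y + b * (x + p * y)) = a * x - b * y"
        "y + b * (x + p * y) = b * x + a * y" for x y
        using pb pa by algebra+
      then show ?thesis
        by (simp add: S1_def S2_def complex_eq_iff a_b_def)
    qed
    then have "(\<integral>\<^sup>+z. f (\<omega> * z) \<partial>lborel) = (\<integral>\<^sup>+z. f (S1 (S2 (S1 z))) \<partial>lborel)"
      by simp
    also have "\<dots> = (\<integral>\<^sup>+z. f (S1 (S2 z)) \<partial>lborel)"
      using nn_integral_complex_shear(1)[OF m1, of p] by (simp add: S1_def)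
    also have "\<dots> = (\<integral>\<^sup>+z. f (S1 z) \<partial>lborel)"
      using nn_integral_complex_shear(2)[OF m2, of b] by (simp add: S2_def)
    also have "\<dots> = (\<integral>\<^sup>+z. f z \<partial>lborel)"
      using nn_integral_complex_shear(1)[of f p] by (simp add: S1_def)
    finally show ?thesis .
  qed
  show ?thesis
  proof (cases "Im \<omega> = 0")
    case False
    then show ?thesis using rot f \<omega> by blast
  next
    case True
    have "Re \<omega> \<noteq> 0" using \<omega> True by (auto simp: cmod_def)
    moreover have "(\<lambda>z. f (\<i> * z)) \<in> borel_measurable borel" using f by measurable
    ultimately have "(\<integral>\<^sup>+z. f (\<i> * ((- \<i> * \<omega>) * z)) \<partial>lborel) = (\<integral>\<^sup>+z. f (\<i> * z) \<partial>lborel)"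
      using \<omega> by (intro rot) (auto simp: norm_mult)
    also have "\<dots> = (\<integral>\<^sup>+z. f z \<partial>lborel)" using f by (intro rot) auto
    finally show ?thesis by (simp add: mult.assoc [symmetric])
  qed
qed

lemma distr_lborel_rotate:
  assumes "cmod \<omega> = 1"
  shows "distr lborel borel ((*) \<omega>) = lborel"
proof (rule measure_eqI)
  fix A assume "A \<in> sets (distr lborel borel ((*) \<omega>))"
  then have A [measurable]: "A \<in> sets borel" by simp
  have "emeasure (distr lborel borel ((*) \<omega>)) A = (\<integral>\<^sup>+z. indicator A (\<omega> * z) \<partial>lborel)"
    using nn_integral_distr [of "(*) \<omega>" lborel borel "indicator A"] by simp
  also have "\<dots> = emeasure lborel A"
    using nn_integral_complex_rotate [OF _ assms, of "indicator A"] by simp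
  finally show "emeasure (distr lborel borel ((*) \<omega>)) A = emeasure lborel A" .
qed auto

text \<open>The area of a centred disc is proportional to the square of its radius, so
  \<open>\<bar>z\<bar>\<^sup>2\<close> is uniformly distributed on the disc. This replaces polar coordinates for
  radial functions.\<close>

lemma distr_cmod_sq_ball:
  assumes r: "0 \<le> r"
  shows "distr (restrict_space lborel (ball (0::complex) r)) borel (\<lambda>z. (cmod z)\<^sup>2)
    = density lborel (\<lambda>t. ennreal pi * indicator {0..r\<^sup>2} t)" (is "?M = ?N")
proof (rule measure_eqI_lessThan)
  fix x :: real
  have vol: "emeasure lborel (ball (0::complex) r) = ennreal (pi * r\<^sup>2)"
    using emeasure_ball [OF r, of "0::complex"] by (simp add: unit_ball_vol_2)
  have cvol: "emeasure lborel (cball (0::complex) s) = ennreal (pi * s\<^sup>2)" if "0 \<le> s" for s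
    using emeasure_cball [OF that, of "0::complex"] by (simp add: unit_ball_vol_2)
  have eM: "emeasure ?M {x<..} = emeasure lborel {z \<in> ball (0::complex) r. x < (cmod z)\<^sup>2}"
    by (subst emeasure_distr)
       (auto simp: emeasure_restrict_space space_restrict_space measurable_restrict_space1
          intro!: arg_cong[of _ _ "emeasure lborel"])
  have eN: "emeasure ?N {x<..} = ennreal pi * emeasure lborel ({0..r\<^sup>2} \<inter> {x<..})"
    by (subst emeasure_density)
      (auto simp: nn_integral_cmult_indicator [symmetric] mult.assoc indicator_inter_arith intro!: nn_integral_cong)
  consider "x < 0" | "0 \<le> x" "x < r\<^sup>2" | "r\<^sup>2 \<le> x" by linarith
  then have "emeasure ?M {x<..} = emeasure ?N {x<..} \<and> emeasure ?M {x<..} < \<infinity>"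
  proof cases
    case 1
    then have "{z \<in> ball (0::complex) r. x < (cmod z)\<^sup>2} = ball 0 r"
      by (auto intro: less_le_trans [OF _ zero_le_power2])
    moreover have "{0..r\<^sup>2} \<inter> {x<..} = {0..r\<^sup>2}" using 1 by auto
    ultimately show ?thesis unfolding eM eN using vol by (simp add: ennreal_mult ennreal_mult_less_top)
  next
    case 2
    have s: "sqrt x \<le> r" "0 \<le> sqrt x" "sqrt x < r"
      using 2 r by (auto simp: real_sqrt_le_iff real_le_lsqrt real_less_lsqrt)
    have "x < (cmod z)\<^sup>2 \<longleftrightarrow> sqrt x < cmod z" for z
      using 2 by (metis norm_ge_zero real_sqrt_less_iff real_sqrt_abs2 real_sqrt_unique)
    then have "{z \<in> ball (0::complex) r. x < (cmod z)\<^sup>2} = ball 0 r - cball 0 (sqrt x)"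
      by (simp only: set_eq_iff mem_Collect_eq Diff_iff mem_ball_0 mem_cball_0 not_le) simp
    moreover have "emeasure lborel (ball (0::complex) r - cball 0 (sqrt x)) = ennreal (pi * r\<^sup>2) - ennreal (pi * (sqrt x)\<^sup>2)"
      using s vol cvol by (subst emeasure_Diff) auto
    moreover have "{0..r\<^sup>2} \<inter> {x<..} = {x<..r\<^sup>2}" using 2 by auto
    ultimately show ?thesis unfolding eM eN using 2
      by (simp add: ennreal_mult [symmetric] ennreal_minus right_diff_distrib)
  next
    case 3
    have "(cmod z)\<^sup>2 \<le> r\<^sup>2" if "cmod z < r" for z using that r by (simp add: power_mono)
    then have "{z \<in> ball (0::complex) r. x < (cmod z)\<^sup>2} = {}"
      using 3 by (force simp: not_less)
    moreover have "{0..r\<^sup>2} \<inter> {x<..} = {}" using 3 by auto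
    ultimately show ?thesis unfolding eM eN by (simp only: emeasure_empty) simp
  qed
  then show "emeasure ?M {x<..} = emeasure ?N {x<..}" "emeasure ?M {x<..} < \<infinity>" by auto
qed auto

lemma integral_ball_cmod_even_power:
  assumes r: "0 \<le> r"
  shows "(\<integral>z. (cmod z) ^ (2 * j) \<partial>restrict_space lborel (ball 0 r)) = pi * r ^ (2 * j + 2) / (j + 1)"
proof -
  let ?B = "restrict_space lborel (ball (0::complex) r)"
  have "(\<integral>z. (cmod z) ^ (2 * j) \<partial>?B) = (\<integral>t. t ^ j \<partial>distr ?B borel (\<lambda>z. (cmod z)\<^sup>2))"
    by (subst integral_distr) (auto simp: power_mult intro!: measurable_restrict_space1)
  also have "\<dots> = (\<integral>t. t ^ j \<partial>density lborel (\<lambda>t. ennreal (pi * indicator {0..r\<^sup>2} t)))"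
    unfolding distr_cmod_sq_ball [OF r]
    by (intro arg_cong2 [of _ _ _ _ "integral\<^sup>L"] arg_cong2 [of _ _ _ _ density]) (auto simp: fun_eq_iff indicator_def)
  also have "\<dots> = pi * (\<integral>t. t ^ j * indicator {0..r\<^sup>2} t \<partial>lborel)"
    by (subst integral_density) (auto simp: mult_ac)
  also have "(\<integral>t. t ^ j * indicator {0..r\<^sup>2} t \<partial>lborel) = (r\<^sup>2) ^ (j + 1) / (j + 1)"
    by (subst integral_power) (auto simp: field_simps)
  also have "(r\<^sup>2) ^ (j + 1) = r ^ (2 * j + 2)"
    by (simp only: power_mult [symmetric]) simp
  finally show ?thesis by simp
qed

section \<open>Parseval's identity on the disc\<close>

lemma integrable_ball_continuous:
  fixes f :: "complex \<Rightarrow> 'b::{banach, second_countable_topology}"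
  assumes "continuous_on (cball 0 r) f"
  shows "integrable (restrict_space lborel (ball 0 r)) f"
proof -
  have "set_integrable lborel (cball 0 r) f"
    unfolding set_integrable_def by (intro borel_integrable_compact assms) auto
  then have "set_integrable lborel (ball 0 r) f"
    by (rule set_integrable_subset) auto
  then show ?thesis
    by (simp add: integrable_restrict_space set_integrable_def)
qed

text \<open>Different monomials are orthogonal because a suitable rotation of the variable, under which the
  integral is invariant, multiplies \<open>z\<^sup>j\<close> times the conjugate of \<open>z\<^sup>l\<close> by \<open>-1\<close>.\<close>

lemma integral_ball_monomials:
  assumes r: "0 \<le> r"
  shows "(\<integral>z. z ^ j * cnj z ^ l \<partial>restrict_space lborel (ball 0 r))
    = (if j = l then of_real (pi * r ^ (2 * j + 2) / (j + 1)) else 0)"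
proof (cases "j = l")
  case True
  have "z ^ j * cnj z ^ j = of_real (cmod z ^ (2 * j))" for z :: complex
    by (simp add: power_mult power_mult_distrib [symmetric] complex_norm_square del: of_real_power)
       (simp add: of_real_power complex_norm_square [symmetric])
  then have "(\<integral>z. z ^ j * cnj z ^ l \<partial>restrict_space lborel (ball 0 r))
    = (\<integral>z. complex_of_real (cmod z ^ (2 * j)) \<partial>restrict_space lborel (ball 0 r))"
    using True by simp
  also have "\<dots> = of_real (pi * r ^ (2 * j + 2) / (j + 1))"
    by (simp only: integral_complex_of_real integral_ball_cmod_even_power [OF r])
  finally show ?thesis using True by simp
next
  case False
  \<comment> \<open>The angle for which the integrand changes sign under the rotation.\<close>
  define \<theta> where "\<theta> = pi / (real j - real l)"
  define g where "g z = indicator (ball 0 r) z *\<^sub>R (z ^ j * cnj z ^ l)" for z :: complex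
  have [measurable]: "g \<in> borel_measurable borel"
    unfolding g_def
    by (intro borel_measurable_scaleR borel_measurable_indicator borel_measurable_continuous_onI continuous_intros) auto
  have "real j * \<theta> - real l * \<theta> = pi"
    using False by (simp add: \<theta>_def divide_simps left_diff_distrib [symmetric])
  moreover have "cis \<theta> ^ j * cnj (cis \<theta>) ^ l = cis (real j * \<theta> - real l * \<theta>)"
    by (simp only: cis_cnj Complex.DeMoivre cis_mult) (simp add: algebra_simps)
  ultimately have "cis \<theta> ^ j * cnj (cis \<theta>) ^ l = -1"
    by simp
  moreover have "(cis \<theta> * z) ^ j * cnj (cis \<theta> * z) ^ l
      = (cis \<theta> ^ j * cnj (cis \<theta>) ^ l) * (z ^ j * cnj z ^ l)" for z
    by (simp add: power_mult_distrib del: cis_cnj)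
  ultimately have "g (cis \<theta> * z) = - g z" for z
    by (simp add: g_def norm_mult indicator_def del: complex_cnj_mult)
  moreover have "(\<integral>z. g z \<partial>lborel) = (\<integral>z. g (cis \<theta> * z) \<partial>lborel)"
    by (subst distr_lborel_rotate [of "cis \<theta>", symmetric], simp, subst integral_distr) auto
  ultimately have "(\<integral>z. g z \<partial>lborel) = 0" by simp
  then show ?thesis
    using False by (simp add: integral_restrict_space g_def)
qed

lemma integral_ball_polynomial:
  assumes r: "0 \<le> r"
  shows "(\<integral>z. (cmod (\<Sum>j<N. c j * z ^ j))\<^sup>2 \<partial>restrict_space lborel (ball 0 r))
    = (\<Sum>j<N. (cmod (c j))\<^sup>2 * (pi * r ^ (2 * j + 2) / (j + 1)))"
proof -
  let ?M = "restrict_space lborel (ball (0::complex) r)"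
  have "of_real ((cmod (\<Sum>j<N. c j * z ^ j))\<^sup>2)
      = (\<Sum>j<N. \<Sum>l<N. (c j * cnj (c l)) * (z ^ j * cnj z ^ l))" for z
    by (simp add: complex_norm_square sum_product mult_ac del: of_real_power)
  then have "complex_of_real (\<integral>z. (cmod (\<Sum>j<N. c j * z ^ j))\<^sup>2 \<partial>?M)
      = (\<integral>z. (\<Sum>j<N. \<Sum>l<N. (c j * cnj (c l)) * (z ^ j * cnj z ^ l)) \<partial>?M)"
    by (simp only: integral_complex_of_real [symmetric])
  also have "\<dots> = (\<Sum>j<N. \<Sum>l<N. (c j * cnj (c l)) * (\<integral>z. z ^ j * cnj z ^ l \<partial>?M))"
  proof -
    have "integrable ?M (\<lambda>z. (c j * cnj (c l)) * (z ^ j * cnj z ^ l))" for j l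
      by (intro integrable_ball_continuous continuous_intros)
    then show ?thesis
      by (simp add: Bochner_Integration.integral_sum)
  qed
  also have "\<dots> = (\<Sum>j<N. c j * cnj (c j) * of_real (pi * r ^ (2 * j + 2) / (j + 1)))"
    by (simp add: integral_ball_monomials [OF r] if_distrib sum.delta cong: if_cong)
  also have "\<dots> = of_real (\<Sum>j<N. (cmod (c j))\<^sup>2 * (pi * r ^ (2 * j + 2) / (j + 1)))"
    by (simp only: of_real_sum of_real_mult [of "(cmod _)\<^sup>2"] complex_norm_square)
  finally show ?thesis by (simp only: of_real_eq_iff)
qed

text \<open>Strictly inside the unit disc the partial sums of the power series are uniformly bounded, so Parseval's
  identity passes from them to \<open>f\<close> by dominated convergence.\<close>

lemma sums_integral_ball_cmod_sq:
  assumes r: "0 \<le> r" "r < 1" and f: "continuous_on (ball 0 1) f"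
    and c: "\<And>z. cmod z < 1 \<Longrightarrow> (\<lambda>j. c j * z ^ j) sums f z"
  shows "(\<lambda>j. (cmod (c j))\<^sup>2 * (pi * r ^ (2 * j + 2) / (j + 1)))
    sums (\<integral>z. (cmod (f z))\<^sup>2 \<partial>restrict_space lborel (ball 0 r))"
proof -
  let ?M = "restrict_space lborel (ball (0::complex) r)"
  have sum_r: "summable (\<lambda>j. cmod (c j) * r ^ j)"
  proof -
    \<comment> \<open>Convergence at a point farther out gives absolute convergence at radius \<open>r\<close>.\<close>
    define s where "s = (r + 1) / 2"
    have s: "r < s" "s < 1" using r by (auto simp: s_def)
    have "summable (\<lambda>j. c j * of_real s ^ j)"
      using c [of "of_real s"] s r by (auto simp: sums_iff)
    from powser_insidea [OF this, of "of_real r"] show ?thesis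
      using s r by (simp add: norm_mult norm_power)
  qed
  have bound: "cmod (\<Sum>j<N. c j * z ^ j) \<le> (\<Sum>j. cmod (c j) * r ^ j)" if "cmod z \<le> r" for N z
  proof -
    have "cmod (\<Sum>j<N. c j * z ^ j) \<le> (\<Sum>j<N. cmod (c j) * r ^ j)"
      by (rule sum_norm_le) (auto simp: norm_mult norm_power intro!: mult_left_mono power_mono that)
    also have "\<dots> \<le> (\<Sum>j. cmod (c j) * r ^ j)"
      using r by (intro sum_le_suminf sum_r) auto
    finally show ?thesis .
  qed
  have cf: "continuous_on (cball 0 r) f"
    using r by (intro continuous_on_subset [OF f]) auto
  have "(\<lambda>N. \<integral>z. (cmod (\<Sum>j<N. c j * z ^ j))\<^sup>2 \<partial>?M) \<longlonglongrightarrow> (\<integral>z. (cmod (f z))\<^sup>2 \<partial>?M)"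
  proof (rule integral_dominated_convergence)
    show "(\<lambda>z. (cmod (f z))\<^sup>2) \<in> borel_measurable ?M"
      by (intro borel_measurable_integrable integrable_ball_continuous continuous_intros cf)
    show "(\<lambda>z. (cmod (\<Sum>j<N. c j * z ^ j))\<^sup>2) \<in> borel_measurable ?M" for N
      by (intro borel_measurable_integrable integrable_ball_continuous continuous_intros)
    show "integrable ?M (\<lambda>z. (\<Sum>j. cmod (c j) * r ^ j)\<^sup>2)"
      by (intro integrable_ball_continuous continuous_intros)
    show "AE z in ?M. (\<lambda>N. (cmod (\<Sum>j<N. c j * z ^ j))\<^sup>2) \<longlonglongrightarrow> (cmod (f z))\<^sup>2"
      using r c by (intro AE_I2 tendsto_intros) (auto simp: space_restrict_space sums_def)
    show "AE z in ?M. norm ((cmod (\<Sum>j<N. c j * z ^ j))\<^sup>2) \<le> (\<Sum>j. cmod (c j) * r ^ j)\<^sup>2" for N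
      by (intro AE_I2) (auto simp: space_restrict_space intro!: power_mono bound)
  qed
  then show ?thesis
    by (simp add: sums_def integral_ball_polynomial [OF r(1)])
qed

text \<open>Parseval's identity on the whole disc, by monotone convergence as the radius tends to one. Stated
  in \<open>[0,\<infinity>]\<close>, it also decides which power series are square integrable.\<close>

lemma nn_integral_disc_cmod_sq:
  assumes f: "continuous_on (ball 0 1) f"
    and c: "\<And>z. cmod z < 1 \<Longrightarrow> (\<lambda>j. c j * z ^ j) sums f z"
  shows "(\<integral>\<^sup>+z\<in>ball 0 1. ennreal ((cmod (f z))\<^sup>2) \<partial>lborel)
    = (\<Sum>j. ennreal (pi * ((cmod (c j))\<^sup>2 / (j + 1))))"
proof -
  define r where "r n = 1 - inverse (real (Suc n))" for n
  have r: "0 \<le> r n" "r n < 1" for n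
    by (auto simp: r_def field_simps)
  have inc: "incseq r"
    by (auto simp: incseq_Suc_iff r_def field_simps)
  have lim: "r \<longlonglongrightarrow> 1"
    unfolding r_def using LIMSEQ_inverse_real_of_nat_add_minus [of 1] by simp
  let ?g = "\<lambda>z. ennreal ((cmod (f z))\<^sup>2)"
  have meas: "(\<lambda>z. ?g z * indicator (ball 0 s) z) \<in> borel_measurable lborel" if "s \<le> 1" for s
  proof -
    have "(\<lambda>z. ?g z) \<in> borel_measurable (restrict_space borel (ball 0 s))"
      using that by (intro measurable_compose [OF _ measurable_ennreal] borel_measurable_continuous_on_restrict
         continuous_intros continuous_on_subset [OF f]) auto
    then show ?thesis
      by (subst (asm) borel_measurable_restrict_space_iff_ennreal) auto
  qed
  have mono: "incseq (\<lambda>n. ennreal ((cmod (c j))\<^sup>2 * (pi * r n ^ (2 * j + 2) / (j + 1))))" for j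
    by (intro incseq_SucI ennreal_leI mult_left_mono divide_right_mono power_mono
          incseq_SucD [OF inc] r) auto
  have un: "?g z * indicator (ball 0 1) z = (SUP n. ?g z * indicator (ball 0 (r n)) z)" for z
  proof (cases "cmod z < 1")
    case True
    then obtain n where n: "cmod z < r n"
      using order_tendstoD(1) [OF lim True] by (auto simp: eventually_sequentially)
    show ?thesis
      using n True by (intro antisym SUP_least SUP_upper2 [of n]) (auto simp: indicator_def)
  next
    case False
    then have "\<not> cmod z < r n" for n using r(2)[of n] by linarith
    with False show ?thesis by simp
  qed
  have "(\<integral>\<^sup>+z\<in>ball 0 1. ?g z \<partial>lborel) = (SUP n. \<integral>\<^sup>+z\<in>ball 0 (r n). ?g z \<partial>lborel)"
    unfolding un
  proof (rule nn_integral_monotone_convergence_SUP)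
    show "incseq (\<lambda>n z. ?g z * indicator (ball 0 (r n)) z)"
      using incseqD [OF inc] by (auto simp: incseq_def le_fun_def indicator_def intro: less_le_trans)
    show "(\<lambda>z. ?g z * indicator (ball 0 (r n)) z) \<in> borel_measurable lborel" for n
      by (rule meas [OF less_imp_le [OF r(2)]])
  qed
  also have "\<dots> = (SUP n. \<Sum>j. ennreal ((cmod (c j))\<^sup>2 * (pi * r n ^ (2 * j + 2) / (j + 1))))"
  proof (rule SUP_cong [OF refl])
    fix n
    have cf: "continuous_on (cball 0 (r n)) f"
      using r(2)[of n] by (intro continuous_on_subset [OF f]) auto
    have "(\<integral>\<^sup>+z\<in>ball 0 (r n). ?g z \<partial>lborel) = (\<integral>\<^sup>+z. ?g z \<partial>restrict_space lborel (ball 0 (r n)))"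
      by (simp add: nn_integral_restrict_space)
    also have "\<dots> = ennreal (\<integral>z. (cmod (f z))\<^sup>2 \<partial>restrict_space lborel (ball 0 (r n)))"
      by (intro nn_integral_eq_integral integrable_ball_continuous continuous_intros cf) auto
    also have "\<dots> = (\<Sum>j. ennreal ((cmod (c j))\<^sup>2 * (pi * r n ^ (2 * j + 2) / (j + 1))))"
      using sums_integral_ball_cmod_sq [OF r f c, of n] r(1)[of n]
      by (subst suminf_ennreal2) (auto simp: sums_iff)
    finally show "(\<integral>\<^sup>+z\<in>ball 0 (r n). ?g z \<partial>lborel) = \<dots>" .
  qed
  also have "\<dots> = (\<Sum>j. SUP n. ennreal ((cmod (c j))\<^sup>2 * (pi * r n ^ (2 * j + 2) / (j + 1))))"
    by (intro ennreal_suminf_SUP_eq [symmetric] mono)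
  also have "\<dots> = (\<Sum>j. ennreal (pi * ((cmod (c j))\<^sup>2 / (j + 1))))"
  proof (rule suminf_cong)
    fix j
    have "(\<lambda>n. ennreal ((cmod (c j))\<^sup>2 * (pi * r n ^ (2 * j + 2) / (j + 1))))
        \<longlonglongrightarrow> (SUP n. ennreal ((cmod (c j))\<^sup>2 * (pi * r n ^ (2 * j + 2) / (j + 1))))"
      by (rule LIMSEQ_SUP [OF mono])
    moreover have "(\<lambda>n. ennreal ((cmod (c j))\<^sup>2 * (pi * r n ^ (2 * j + 2) / (j + 1))))
        \<longlonglongrightarrow> ennreal ((cmod (c j))\<^sup>2 * (pi * 1 ^ (2 * j + 2) / (j + 1)))"
      by (intro tendsto_intros lim tendsto_ennrealI) auto
    ultimately show "(SUP n. ennreal ((cmod (c j))\<^sup>2 * (pi * r n ^ (2 * j + 2) / (j + 1))))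
        = ennreal (pi * ((cmod (c j))\<^sup>2 / (j + 1)))"
      by (auto dest: LIMSEQ_unique simp: mult.commute)
  qed
  finally show ?thesis .
qed

section \<open>The Bergman space as a weighted sequence space\<close>

text \<open>The Bergman space is handled throughout via this relation between a function and its Taylor coefficients: the
  last conjunct is, by Parseval's identity, the finiteness of the norm, and the middle one is the convention for
  values outside the disc.\<close>

definition bergman_series :: "(complex \<Rightarrow> complex) \<Rightarrow> (nat \<Rightarrow> complex) \<Rightarrow> bool" where
  "bergman_series f c \<longleftrightarrow>
     (\<forall>z. cmod z < 1 \<longrightarrow> (\<lambda>j. c j * z ^ j) sums f z)
   \<and> (\<forall>z. z \<notin> ball 0 1 \<longrightarrow> f z = 0)
   \<and> summable (\<lambda>j. (cmod (c j))\<^sup>2 / (j + 1))"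

lemma summable_comparison_nonneg:
  fixes f g :: "nat \<Rightarrow> real"
  assumes "summable g" "\<And>j. f j \<le> g j" "\<And>j. 0 \<le> f j"
  shows "summable f"
  using assms by (intro summable_comparison_test' [of g 0 f]) auto

lemma powser_sums_holomorphic:
  assumes "\<And>z. cmod z < 1 \<Longrightarrow> (\<lambda>j. c j * z ^ j) sums f z"
  shows "f holomorphic_on ball 0 1"
  using assms by (intro power_series_holomorphic [of 0 1 c]) auto

lemma nn_integral_disc_measure:
  "(\<integral>\<^sup>+z. f z \<partial>disc_measure) = (\<integral>\<^sup>+z\<in>ball 0 1. f z \<partial>lborel)"
  by (simp add: nn_integral_restrict_space nn_integral_completion)

lemma borel_measurable_disc_continuous:
  fixes f :: "complex \<Rightarrow> 'b::topological_space"
  assumes "continuous_on (ball 0 1) f"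
  shows "f \<in> borel_measurable disc_measure"
  using assms by (intro continuous_imp_measurable_on_sets_lebesgue) auto

lemma bergman_series_cmod_sq:
  assumes "bergman_series f c"
  shows "integrable disc_measure (\<lambda>z. (cmod (f z))\<^sup>2)"
    and "(\<integral>z. (cmod (f z))\<^sup>2 \<partial>disc_measure) = pi * (\<Sum>j. (cmod (c j))\<^sup>2 / (j + 1))"
proof -
  have c: "\<And>z. cmod z < 1 \<Longrightarrow> (\<lambda>j. c j * z ^ j) sums f z"
    and sm: "summable (\<lambda>j. (cmod (c j))\<^sup>2 / (j + 1))"
    using assms by (auto simp: bergman_series_def)
  have cont: "continuous_on (ball 0 1) f"
    by (intro holomorphic_on_imp_continuous_on powser_sums_holomorphic [of c] c)
  have "(\<integral>\<^sup>+z. ennreal ((cmod (f z))\<^sup>2) \<partial>disc_measure) = (\<Sum>j. ennreal (pi * ((cmod (c j))\<^sup>2 / (j + 1))))"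
    unfolding nn_integral_disc_measure by (rule nn_integral_disc_cmod_sq [OF cont c])
  also have "\<dots> = ennreal (\<Sum>j. pi * ((cmod (c j))\<^sup>2 / (j + 1)))"
    by (intro suminf_ennreal2 summable_mult sm) auto
  also have "(\<Sum>j. pi * ((cmod (c j))\<^sup>2 / (j + 1))) = pi * (\<Sum>j. (cmod (c j))\<^sup>2 / (j + 1))"
    by (rule suminf_mult [OF sm])
  finally have nn: "(\<integral>\<^sup>+z. ennreal ((cmod (f z))\<^sup>2) \<partial>disc_measure)
      = ennreal (pi * (\<Sum>j. (cmod (c j))\<^sup>2 / (j + 1)))" .
  have meas: "(\<lambda>z. (cmod (f z))\<^sup>2) \<in> borel_measurable disc_measure"
    by (intro borel_measurable_disc_continuous continuous_intros cont)
  show "integrable disc_measure (\<lambda>z. (cmod (f z))\<^sup>2)"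
    using nn by (intro integrableI_nonneg meas) auto
  show "(\<integral>z. (cmod (f z))\<^sup>2 \<partial>disc_measure) = pi * (\<Sum>j. (cmod (c j))\<^sup>2 / (j + 1))"
    using nn sm by (subst integral_eq_nn_integral [OF meas]) (auto simp: suminf_nonneg)
qed

text \<open>The Bergman space consists exactly of the functions with a weighted square summable coefficient
  sequence; in both directions the reason is Parseval's identity in \<open>[0,\<infinity>]\<close>.\<close>

lemma bergman_space_iff_series: "f \<in> bergman_space \<longleftrightarrow> (\<exists>c. bergman_series f c)"
proof
  assume f: "f \<in> bergman_space"
  define c where "c j = (deriv ^^ j) f 0 / fact j" for j
  have hol: "f holomorphic_on ball 0 1" and int: "integrable disc_measure (\<lambda>z. (cmod (f z))\<^sup>2)"
    using f by (auto simp: bergman_space_def)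
  have c: "(\<lambda>j. c j * z ^ j) sums f z" if "cmod z < 1" for z
    using holomorphic_power_series [OF hol, of z] that by (simp add: c_def)
  have "(\<Sum>j. ennreal (pi * ((cmod (c j))\<^sup>2 / (j + 1)))) = (\<integral>\<^sup>+z. ennreal ((cmod (f z))\<^sup>2) \<partial>disc_measure)"
    unfolding nn_integral_disc_measure
    by (rule nn_integral_disc_cmod_sq [OF holomorphic_on_imp_continuous_on [OF hol] c, symmetric])
  also have "\<dots> \<noteq> \<infinity>"
    using int by (simp add: nn_integral_eq_integral)
  finally have "summable (\<lambda>j. pi * ((cmod (c j))\<^sup>2 / (j + 1)))"
    by (intro summable_suminf_not_top) auto
  then have "summable (\<lambda>j. (cmod (c j))\<^sup>2 / (j + 1))"
    by (simp only: summable_cmult_iff) auto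
  then show "\<exists>c. bergman_series f c"
    using c f by (auto simp: bergman_series_def bergman_space_def intro!: exI [of _ c])
next
  assume "\<exists>c. bergman_series f c"
  then obtain c where c: "bergman_series f c" ..
  then show "f \<in> bergman_space"
    using bergman_series_cmod_sq(1) [OF c] powser_sums_holomorphic [of c f]
    by (auto simp: bergman_series_def bergman_space_def)
qed

text \<open>The Riesz--Fischer part, through which all members of the Bergman space below are constructed: the
  projections and the values of the adjoint are written down by their coefficients. The series converges in the
  disc since \<open>2\<bar>c\<^sub>j z\<^sup>j\<bar> \<le> \<bar>c\<^sub>j\<bar>\<^sup>2/(j+1) + (j+1)\<bar>z\<bar>\<^bsup>2j\<^esup>\<close>
  by the inequality between arithmetic and geometric mean.\<close>

lemma bergman_series_exists:
  fixes c :: "nat \<Rightarrow> complex"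
  assumes c: "summable (\<lambda>j. (cmod (c j))\<^sup>2 / (j + 1))"
  shows "\<exists>f. bergman_series f c"
proof -
  define f where "f z = (if cmod z < 1 then (\<Sum>j. c j * z ^ j) else 0)" for z
  have "(\<lambda>j. c j * z ^ j) sums f z" if z: "cmod z < 1" for z
  proof -
    have q: "(cmod z)\<^sup>2 < 1"
      using z by (simp add: abs_square_less_1)
    have "summable (\<lambda>j. (cmod (c j))\<^sup>2 / (j + 1) + real (Suc j) * ((cmod z)\<^sup>2) ^ j)"
      using geometric_deriv_sums [of "(cmod z)\<^sup>2"] q
      by (intro summable_add c) (auto simp: sums_iff)
    moreover have "norm (c j * z ^ j) \<le> (cmod (c j))\<^sup>2 / (j + 1) + real (Suc j) * ((cmod z)\<^sup>2) ^ j" for j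
    proof -
      define s where "s = sqrt (real j + 1)"
      have s: "s > 0" "s\<^sup>2 = 1 + real j" by (auto simp: s_def)
      have "2 * ((cmod (c j) / s) * (s * cmod z ^ j)) \<le> (cmod (c j) / s)\<^sup>2 + (s * cmod z ^ j)\<^sup>2"
        using sum_squares_bound [of "cmod (c j) / s" "s * cmod z ^ j"] by (simp only: mult.assoc)
      moreover have "(cmod (c j) / s) * (s * cmod z ^ j) = norm (c j * z ^ j)"
        using s by (simp add: norm_mult norm_power)
      moreover have "norm (c j * z ^ j) \<ge> 0" by simp
      moreover have "(cmod (c j) / s)\<^sup>2 + (s * cmod z ^ j)\<^sup>2
          = (cmod (c j))\<^sup>2 / (j + 1) + real (Suc j) * ((cmod z)\<^sup>2) ^ j"
        using s by (simp add: power_divide power_mult_distrib power_mult [symmetric] mult.commute)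
      ultimately show ?thesis by linarith
    qed
    ultimately have "summable (\<lambda>j. c j * z ^ j)"
      by (rule summable_comparison_test' [where N = 0])
    then show ?thesis using z by (simp add: f_def summable_sums)
  qed
  then have "bergman_series f c"
    using c by (auto simp: bergman_series_def f_def)
  then show ?thesis by blast
qed

lemma bergman_series_cmult:
  assumes "bergman_series f c"
  shows "bergman_series (\<lambda>z. a * f z) (\<lambda>j. a * c j)"
proof -
  have "summable (\<lambda>j. (cmod a)\<^sup>2 * ((cmod (c j))\<^sup>2 / (j + 1)))"
    using assms by (intro summable_mult) (simp add: bergman_series_def)
  then show ?thesis
    using assms by (auto simp: bergman_series_def norm_mult power_mult_distrib mult.assoc intro!: sums_mult)
qed

lemma bergman_series_add:
  assumes "bergman_series f c" "bergman_series g d"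
  shows "bergman_series (\<lambda>z. f z + g z) (\<lambda>j. c j + d j)"
proof -
  have "summable (\<lambda>j. 2 * ((cmod (c j))\<^sup>2 / (j + 1)) + 2 * ((cmod (d j))\<^sup>2 / (j + 1)))"
    using assms by (intro summable_mult summable_add) (auto simp: bergman_series_def)
  moreover have "(cmod (c j + d j))\<^sup>2 / (j + 1) \<le> 2 * ((cmod (c j))\<^sup>2 / (j + 1)) + 2 * ((cmod (d j))\<^sup>2 / (j + 1))" for j
  proof -
    have "(cmod (c j + d j))\<^sup>2 \<le> (cmod (c j) + cmod (d j))\<^sup>2"
      by (intro power_mono norm_triangle_ineq) auto
    also have "\<dots> \<le> 2 * (cmod (c j))\<^sup>2 + 2 * (cmod (d j))\<^sup>2"
      using sum_squares_bound [of "cmod (c j)" "cmod (d j)"] by (simp add: power2_sum)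
    finally show ?thesis by (simp add: divide_simps)
  qed
  ultimately have "summable (\<lambda>j. (cmod (c j + d j))\<^sup>2 / (j + 1))"
    by (rule summable_comparison_nonneg) simp
  then show ?thesis
    using assms by (auto simp: bergman_series_def distrib_right intro!: sums_add)
qed

lemma bergman_series_diff:
  assumes "bergman_series f c" "bergman_series g d"
  shows "bergman_series (\<lambda>z. f z - g z) (\<lambda>j. c j - d j)"
  using bergman_series_add [OF assms(1) bergman_series_cmult [OF assms(2), of "-1"]] by simp

text \<open>Polarisation of Parseval's identity. The pointwise identity expresses the product by integrable
  squared moduli, which gives its integrability as well.\<close>

lemma bergman_series_inner:
  assumes f: "bergman_series f c" and g: "bergman_series g d"
  shows "integrable disc_measure (\<lambda>z. f z * cnj (g z))"
    and "(\<lambda>j. of_real pi * (c j * cnj (d j) / of_nat (j + 1))) sums L2_inner f g"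
proof -
  have polar: "z * cnj w = (of_real ((cmod (z + w))\<^sup>2) - of_real ((cmod (z + (-1) * w))\<^sup>2)
      + \<i> * of_real ((cmod (z + \<i> * w))\<^sup>2) - \<i> * of_real ((cmod (z + (- \<i>) * w))\<^sup>2)) / 4" for z w
    unfolding complex_norm_square by (simp add: algebra_simps) 
  have ser: "bergman_series (\<lambda>z. f z + u * g z) (\<lambda>j. c j + u * d j)" for u
    by (intro bergman_series_add bergman_series_cmult f g)
  define N where "N u = complex_of_real (\<integral>z. (cmod (f z + u * g z))\<^sup>2 \<partial>disc_measure)" for u
  have N: "has_bochner_integral disc_measure (\<lambda>z. complex_of_real ((cmod (f z + u * g z))\<^sup>2)) (N u)" for u
    using bergman_series_cmod_sq(1) [OF ser [of u]]
    unfolding N_def by (simp add: has_bochner_integral_iff del: of_real_power)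
  have Ns: "(\<lambda>j. of_real pi * of_real ((cmod (c j + u * d j))\<^sup>2) / of_nat (j + 1)) sums N u" for u
  proof -
    have "summable (\<lambda>j. (cmod (c j + u * d j))\<^sup>2 / (j + 1))"
      using ser [of u] by (simp add: bergman_series_def)
    then have "(\<lambda>j. pi * ((cmod (c j + u * d j))\<^sup>2 / (j + 1))) sums (pi * (\<Sum>j. (cmod (c j + u * d j))\<^sup>2 / (j + 1)))"
      by (intro sums_mult summable_sums)
    then have "(\<lambda>j. complex_of_real (pi * ((cmod (c j + u * d j))\<^sup>2 / (j + 1)))) sums N u"
      unfolding N_def bergman_series_cmod_sq(2) [OF ser [of u]] by (rule sums_of_real)
    then show ?thesis by (simp add: add_ac)
  qed
  have int: "has_bochner_integral disc_measure (\<lambda>z. f z * cnj (g z))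
     ((N 1 - N (-1) + \<i> * N \<i> - \<i> * N (- \<i>)) / 4)"
    unfolding polar using N [of 1]
    by (intro has_bochner_integral_divide has_bochner_integral_diff has_bochner_integral_add
          has_bochner_integral_mult_right N) auto
  then show "integrable disc_measure (\<lambda>z. f z * cnj (g z))"
    by (simp add: has_bochner_integral_iff)
  have alg: "(p * A / n - p * B / n + \<i> * (p * C / n) - \<i> * (p * D / n)) / 4
      = p * ((A - B + \<i> * C - \<i> * D) / 4 / n)" for p A B C D n :: complex
    by (simp add: algebra_simps add_divide_distrib diff_divide_distrib)
  let ?t = "\<lambda>u j. of_real pi * of_real ((cmod (c j + u * d j))\<^sup>2) / of_nat (j + 1)"
  have "(\<lambda>j. (?t 1 j - ?t (-1) j + \<i> * ?t \<i> j - \<i> * ?t (- \<i>) j) / 4)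
      sums ((N 1 - N (-1) + \<i> * N \<i> - \<i> * N (- \<i>)) / 4)"
    by (intro sums_divide sums_diff sums_add sums_mult Ns)
  also have "(N 1 - N (-1) + \<i> * N \<i> - \<i> * N (- \<i>)) / 4 = L2_inner f g"
    using int by (simp add: has_bochner_integral_iff L2_inner_def)
  finally show "(\<lambda>j. of_real pi * (c j * cnj (d j) / of_nat (j + 1))) sums L2_inner f g"
    unfolding polar alg by simp
qed

text \<open>The coefficients determine the function by definition; conversely, by Parseval's identity the
  coefficients of the zero function vanish.\<close>

lemma bergman_series_unique:
  assumes "bergman_series f c"
  shows "bergman_series f d \<Longrightarrow> c = d" and "bergman_series g c \<Longrightarrow> f = g"
proof -
  assume "bergman_series f d"
  from bergman_series_diff [OF assms this] have s: "bergman_series (\<lambda>z. 0) (\<lambda>j. c j - d j)"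
    by simp
  then have "(\<Sum>j. (cmod (c j - d j))\<^sup>2 / (j + 1)) = 0"
    using bergman_series_cmod_sq(2) [OF s] by simp
  then show "c = d"
    using s by (subst (asm) suminf_eq_zero_iff) (auto simp: bergman_series_def fun_eq_iff add_eq_0_iff)
next
  assume "bergman_series g c"
  with assms show "f = g"
    by (force simp: bergman_series_def fun_eq_iff intro: sums_unique2)
qed

lemma bergman_series_power_mult:
  assumes "bergman_series f c"
  shows "bergman_series (\<lambda>z. z ^ m * f z) (\<lambda>j. if j < m then 0 else c (j - m))"
  unfolding bergman_series_def
proof (intro conjI allI impI)
  fix z :: complex assume "cmod z < 1"
  then have "(\<lambda>j. z ^ m * (c j * z ^ j)) sums (z ^ m * f z)"
    using assms by (intro sums_mult) (simp add: bergman_series_def)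
  then show "(\<lambda>j. (if j < m then 0 else c (j - m)) * z ^ j) sums (z ^ m * f z)"
    by (subst sums_zero_iff_shift [of m, symmetric]) (auto simp: power_add mult_ac)
next
  have "summable (\<lambda>j. (cmod (c j))\<^sup>2 / (j + 1))"
    using assms by (simp add: bergman_series_def)
  then have "summable (\<lambda>j. (cmod (if j + m < m then 0 else c (j + m - m)))\<^sup>2 / real (j + m + 1))"
    by (rule summable_comparison_nonneg) (auto intro!: divide_left_mono)
  then show "summable (\<lambda>j. (cmod (if j < m then 0 else c (j - m)))\<^sup>2 / real (j + 1))"
    by (subst summable_iff_shift [of _ m, symmetric])
qed (use assms in \<open>auto simp: bergman_series_def\<close>)

section \<open>Weighted shifts\<close>

lemma sums_shifted:
  fixes f g :: "nat \<Rightarrow> complex"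
  assumes "f sums s" and "\<And>j. j < \<delta> \<Longrightarrow> f j = 0" and "\<And>j. f (j + \<delta>) = g j"
  shows "g sums s"
  using sums_zero_iff_shift [of \<delta> f s] assms by simp

text \<open>Boundedness of a weighted forward shift by \<open>\<delta>\<close> places, in terms of coefficients: the weights
  \<open>1/(j+1)\<close> of the norm decrease, so that the shift itself is a contraction.\<close>

lemma summable_weighted_shift:
  fixes w c :: "nat \<Rightarrow> complex"
  assumes c: "summable (\<lambda>j. (cmod (c j))\<^sup>2 / (j + 1))" and w: "\<And>j. cmod (w j) \<le> W"
  shows "summable (\<lambda>j. (cmod (if j < \<delta> then 0 else w (j - \<delta>) * c (j - \<delta>)))\<^sup>2 / (j + 1))" (is "summable ?s")
    and "(\<Sum>j. (cmod (if j < \<delta> then 0 else w (j - \<delta>) * c (j - \<delta>)))\<^sup>2 / (j + 1))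
      \<le> W\<^sup>2 * (\<Sum>j. (cmod (c j))\<^sup>2 / (j + 1))"
proof -
  have le: "?s (j + \<delta>) \<le> W\<^sup>2 * ((cmod (c j))\<^sup>2 / (j + 1))" for j
  proof -
    have "?s (j + \<delta>) = (cmod (w j))\<^sup>2 * ((cmod (c j))\<^sup>2 / real (j + \<delta> + 1))"
      by (simp add: norm_mult power_mult_distrib)
    also have "\<dots> \<le> W\<^sup>2 * ((cmod (c j))\<^sup>2 / (j + 1))"
      by (intro mult_mono power_mono w divide_left_mono) auto
    finally show ?thesis .
  qed
  have sW: "summable (\<lambda>j. W\<^sup>2 * ((cmod (c j))\<^sup>2 / (j + 1)))"
    by (rule summable_mult [OF c])
  have sh: "summable (\<lambda>j. ?s (j + \<delta>))"
    using sW le by (rule summable_comparison_nonneg) simp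
  then show s: "summable ?s" by (rule summable_iff_shift [THEN iffD1])
  have "suminf ?s = (\<Sum>j. ?s (j + \<delta>)) + (\<Sum>j<\<delta>. ?s j)"
    by (rule suminf_split_initial_segment [OF s])
  also have "(\<Sum>j<\<delta>. ?s j) = 0" by simp
  also have "(\<Sum>j. ?s (j + \<delta>)) \<le> (\<Sum>j. W\<^sup>2 * ((cmod (c j))\<^sup>2 / (j + 1)))"
    by (rule suminf_le [OF le sh sW])
  also have "\<dots> = W\<^sup>2 * (\<Sum>j. (cmod (c j))\<^sup>2 / (j + 1))"
    by (rule suminf_mult [OF c])
  finally show "suminf ?s \<le> W\<^sup>2 * (\<Sum>j. (cmod (c j))\<^sup>2 / (j + 1))" by simp
qed

lemma L2_inner_commute: "L2_inner g f = cnj (L2_inner f g)"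
  unfolding L2_inner_def by (subst Bochner_Integration.integral_cnj [symmetric]) (simp add: mult.commute)

text \<open>Testing against the monomials recovers the coefficients. This gives the uniqueness that the definite
  descriptions of projection and adjoint need.\<close>

lemma bergman_space_eqI:
  assumes f: "f \<in> bergman_space" and g: "g \<in> bergman_space"
    and eq: "\<And>u. u \<in> bergman_space \<Longrightarrow> L2_inner u f = L2_inner u g"
  shows "f = g"
proof -
  obtain c d where c: "bergman_series f c" and d: "bergman_series g d"
    using f g by (auto simp: bergman_space_iff_series)
  have "c j = d j" for j
  proof -
    let ?e = "\<lambda>i. if i = j then 1 else 0 :: complex"
    have "summable (\<lambda>i. (cmod (?e i))\<^sup>2 / (i + 1))"
      by (rule summable_finite [of "{j}"]) auto
    from bergman_series_exists [OF this] obtain u where u: "bergman_series u ?e" ..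
    have "L2_inner u h = of_real pi * (cnj (b j) / of_nat (j + 1))" if h: "bergman_series h b" for h b
    proof (rule sums_unique2 [OF bergman_series_inner(2) [OF u h]])
      have "(\<lambda>i. if i = j then of_real pi * (cnj (b i) / of_nat (i + 1)) else 0)
          sums (of_real pi * (cnj (b j) / of_nat (j + 1)))"
        by (rule sums_single [where f = "\<lambda>i. of_real pi * (cnj (b i) / of_nat (i + 1))"])
      then show "(\<lambda>i. of_real pi * (?e i * cnj (b i) / of_nat (i + 1)))
          sums (of_real pi * (cnj (b j) / of_nat (j + 1)))"
        by (rule back_subst [where P = "\<lambda>t. t sums _"]) auto
    qed
    from this [OF c] this [OF d] eq [of u] u show ?thesis
      by (auto simp: bergman_space_iff_series simp del: of_nat_Suc of_nat_add)
  qed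
  then have "c = d" by auto
  then show ?thesis using bergman_series_unique(2) [OF c, of g] d by simp
qed

text \<open>The adjoint is the weighted backward shift. The factor \<open>(j+1)/(j+\<delta>+1)\<close> is the quotient of the squared norms of
  \<open>z\<^bsup>j+\<delta>\<^esup>\<close> and \<open>z\<^sup>j\<close>.\<close>

lemma adjoint_weighted_shift:
  assumes T: "\<And>f c. bergman_series f c \<Longrightarrow>
      bergman_series (T f) (\<lambda>j. if j < \<delta> then 0 else w (j - \<delta>) * c (j - \<delta>))"
    and w: "\<And>j. cmod (w j) \<le> W" and v: "bergman_series v d"
  shows "bergman_series (adjoint_operator T v)
      (\<lambda>j. cnj (w j) * of_real (real (j + 1) / real (j + \<delta> + 1)) * d (j + \<delta>))" (is "bergman_series _ ?e")
proof -
  have "summable (\<lambda>j. (cmod (d j))\<^sup>2 / (j + 1))"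
    using v by (simp add: bergman_series_def)
  then have "summable (\<lambda>j. (cmod (d (j + \<delta>)))\<^sup>2 / real (j + \<delta> + 1))"
    by (rule summable_ignore_initial_segment)
  then have "summable (\<lambda>j. W\<^sup>2 * ((cmod (d (j + \<delta>)))\<^sup>2 / real (j + \<delta> + 1)))"
    by (rule summable_mult)
  moreover have "(cmod (?e j))\<^sup>2 / (j + 1) \<le> W\<^sup>2 * ((cmod (d (j + \<delta>)))\<^sup>2 / real (j + \<delta> + 1))" for j
  proof -
    define x y where "x = real j + 1" and "y = real (j + \<delta>) + 1"
    have xy: "0 < x" "x \<le> y" by (auto simp: x_def y_def)
    have xy_eq: "real (j + 1) = x" "real (j + \<delta> + 1) = y" by (auto simp: x_def y_def)
    have "(cmod (?e j))\<^sup>2 / (j + 1) = (cmod (w j))\<^sup>2 * ((cmod (d (j + \<delta>)))\<^sup>2 * ((x / y)\<^sup>2 / x))"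
      unfolding xy_eq by (simp add: norm_mult power_mult_distrib norm_divide power_divide)
    also have "(x / y)\<^sup>2 / x \<le> 1 / y"
      using xy by (simp add: power2_eq_square divide_simps)
    then have "(cmod (w j))\<^sup>2 * ((cmod (d (j + \<delta>)))\<^sup>2 * ((x / y)\<^sup>2 / x))
        \<le> W\<^sup>2 * ((cmod (d (j + \<delta>)))\<^sup>2 * (1 / y))"
      using xy by (intro mult_mono power_mono w) auto
    finally show ?thesis unfolding xy_eq by simp
  qed
  ultimately have "summable (\<lambda>j. (cmod (?e j))\<^sup>2 / (j + 1))"
    by (rule summable_comparison_nonneg) simp
  from bergman_series_exists [OF this] obtain h where h: "bergman_series h ?e" ..
  have inner: "L2_inner (T u) v = L2_inner u h" if u: "u \<in> bergman_space" for u
  proof -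
    obtain c where c: "bergman_series u c"
      using u by (auto simp: bergman_space_iff_series)
    let ?t = "\<lambda>j. of_real pi * (c j * cnj (?e j) / of_nat (j + 1))"
    have "?t sums L2_inner (T u) v"
    proof (rule sums_shifted [where \<delta> = "\<delta>", OF bergman_series_inner(2) [OF T [OF c] v]])
      show "of_real pi * ((if j + \<delta> < \<delta> then 0 else w (j + \<delta> - \<delta>) * c (j + \<delta> - \<delta>)) * cnj (d (j + \<delta>)) / of_nat (j + \<delta> + 1))
          = ?t j" for j
      proof -
        have "p * (a * b * d / y) = p * (b * (a * (x / y) * d) / x)" if "x \<noteq> 0" for p a b d x y :: complex
          using that by simp
        from this [of "of_nat (j + 1)"] show ?thesis
          by (simp del: of_nat_add of_nat_Suc)
      qed
    qed auto
    with bergman_series_inner(2) [OF c h] show ?thesis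
      by (rule sums_unique2 [symmetric])
  qed
  have hs: "h \<in> bergman_space" using h by (auto simp: bergman_space_iff_series)
  have "adjoint_operator T v = h"
    unfolding adjoint_operator_def
  proof (rule the_equality)
    show "h \<in> bergman_space \<and> (\<forall>u\<in>bergman_space. L2_inner (T u) v = L2_inner u h)"
      using hs inner by blast
    show "h' = h" if "h' \<in> bergman_space \<and> (\<forall>u\<in>bergman_space. L2_inner (T u) v = L2_inner u h')" for h'
      using that inner by (intro bergman_space_eqI hs) auto
  qed
  with h show ?thesis by simp
qed

text \<open>In the monomial basis the self-commutator of a weighted shift is diagonal. Its \<open>j\<close>-th entry
  is \<open>p\<^sub>j - p\<^bsub>j-\<delta>\<^esub>\<close> with \<open>p\<^sub>j = \<bar>w\<^sub>j\<bar>\<^sup>2 (j+1)/(j+\<delta>+1)\<close>, where the second term is absent for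
  \<open>j < \<delta>\<close>; hence hyponormality follows from monotonicity of \<open>p\<close> along steps of length \<open>\<delta>\<close>.\<close>

lemma hyponormal_weighted_shift:
  assumes T: "\<And>f c. bergman_series f c \<Longrightarrow>
      bergman_series (T f) (\<lambda>j. if j < \<delta> then 0 else w (j - \<delta>) * c (j - \<delta>))"
    and w: "\<And>j. cmod (w j) \<le> W"
    and mono: "\<And>j. (cmod (w j))\<^sup>2 * (real (j + 1) / real (j + \<delta> + 1))
        \<le> (cmod (w (j + \<delta>)))\<^sup>2 * (real (j + \<delta> + 1) / real (j + \<delta> + \<delta> + 1))"
  shows "hyponormal T"
  unfolding hyponormal_def
proof (intro conjI ballI)
  have W: "W \<ge> 0" using w [of 0] norm_ge_zero order_trans by blast
  have nrm: "L2_norm f = sqrt (pi * (\<Sum>j. (cmod (c j))\<^sup>2 / (j + 1)))" if "bergman_series f c" for f c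
    unfolding L2_norm_def bergman_series_cmod_sq(2) [OF that] ..
  show "bounded_operator T"
    unfolding bounded_operator_def
  proof (intro conjI ballI allI exI)
    fix f assume "f \<in> bergman_space"
    then obtain c where c: "bergman_series f c" by (auto simp: bergman_space_iff_series)
    show "T f \<in> bergman_space"
      using T [OF c] by (auto simp: bergman_space_iff_series)
    have "pi * (\<Sum>j. (cmod (if j < \<delta> then 0 else w (j - \<delta>) * c (j - \<delta>)))\<^sup>2 / (j + 1))
        \<le> W\<^sup>2 * (pi * (\<Sum>j. (cmod (c j))\<^sup>2 / (j + 1)))"
      using summable_weighted_shift(2) [OF _ w, of c \<delta>] c by (simp add: bergman_series_def mult_ac)
    then have "L2_norm (T f) \<le> sqrt (W\<^sup>2 * (pi * (\<Sum>j. (cmod (c j))\<^sup>2 / (j + 1))))"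
      unfolding nrm [OF T [OF c]] by (rule real_sqrt_le_mono)
    also have "\<dots> = W * L2_norm f"
      unfolding nrm [OF c] real_sqrt_mult [of "W\<^sup>2"] using W by simp
    finally show "L2_norm (T f) \<le> W * L2_norm f" .
    show "T (\<lambda>z. a * f z) = (\<lambda>z. a * T f z)" for a
    proof (rule bergman_series_unique(2))
      show "bergman_series (T (\<lambda>z. a * f z)) (\<lambda>j. if j < \<delta> then 0 else w (j - \<delta>) * (a * c (j - \<delta>)))"
        by (intro T bergman_series_cmult c)
      show "bergman_series (\<lambda>z. a * T f z) (\<lambda>j. if j < \<delta> then 0 else w (j - \<delta>) * (a * c (j - \<delta>)))"
        using bergman_series_cmult [OF T [OF c], of a]
        by (simp add: if_distrib mult.left_commute cong: if_cong)
    qed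
    fix g assume "g \<in> bergman_space"
    then obtain d where d: "bergman_series g d" by (auto simp: bergman_space_iff_series)
    show "T (\<lambda>z. f z + g z) = (\<lambda>z. T f z + T g z)"
    proof (rule bergman_series_unique(2))
      show "bergman_series (T (\<lambda>z. f z + g z))
          (\<lambda>j. if j < \<delta> then 0 else w (j - \<delta>) * (c (j - \<delta>) + d (j - \<delta>)))"
        by (intro T bergman_series_add c d)
      have "(\<lambda>j. (if j < \<delta> then 0 else w (j - \<delta>) * c (j - \<delta>)) + (if j < \<delta> then 0 else w (j - \<delta>) * d (j - \<delta>)))
        = (\<lambda>j. if j < \<delta> then 0 else w (j - \<delta>) * (c (j - \<delta>) + d (j - \<delta>)))"
        by (auto simp: distrib_left)
      then show "bergman_series (\<lambda>z. T f z + T g z)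
          (\<lambda>j. if j < \<delta> then 0 else w (j - \<delta>) * (c (j - \<delta>) + d (j - \<delta>)))"
        using bergman_series_add [OF T [OF c] T [OF d]] by simp
    qed
  qed
next
  fix u assume "u \<in> bergman_space"
  then obtain c where c: "bergman_series u c" by (auto simp: bergman_space_iff_series)
  define R where "R j = real (j + 1) / real (j + \<delta> + 1)" for j
  define p where "p j = (cmod (w j))\<^sup>2 * R j" for j
  define q where "q j = p j - (if j < \<delta> then 0 else p (j - \<delta>))" for j
  have p: "p j \<le> p (j + \<delta>)" for j
    using mono [of j] by (simp add: p_def R_def add_ac)
  have q: "q j \<ge> 0" for j
    using p [of "j - \<delta>"] by (cases "j < \<delta>") (auto simp: q_def p_def R_def)
  have adj: "bergman_series (adjoint_operator T v) (\<lambda>j. cnj (w j) * of_real (R j) * d (j + \<delta>))"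
    if "bergman_series v d" for v d
    unfolding R_def by (rule adjoint_weighted_shift [of T \<delta> w W, OF T w that])
  have p_eq: "of_real (p j) = w j * cnj (w j) * of_real (R j)" for j
    unfolding p_def of_real_mult complex_norm_square ..
  have "bergman_series (self_commutator T u) (\<lambda>j. of_real (q j) * c j)"
  proof -
    have "cnj (w j) * of_real (R j) * (if j + \<delta> < \<delta> then 0 else w (j + \<delta> - \<delta>) * c (j + \<delta> - \<delta>))
          - (if j < \<delta> then 0 else w (j - \<delta>) * (cnj (w (j - \<delta>)) * of_real (R (j - \<delta>)) * c (j - \<delta> + \<delta>)))
        = of_real (q j) * c j" for j
      by (simp add: q_def p_eq algebra_simps)
    then show ?thesis
      unfolding self_commutator_def
      using bergman_series_diff [OF adj [OF T [OF c]] T [OF adj [OF c]]] by (simp only:)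
  qed
  from bergman_series_inner(2) [OF this c]
  have s: "(\<lambda>j. of_real pi * (of_real (q j) * c j * cnj (c j) / of_nat (j + 1)))
      sums L2_inner (self_commutator T u) u" .
  have "of_real pi * (of_real (q j) * c j * cnj (c j) / of_nat (j + 1))
      = complex_of_real (pi * (q j * (cmod (c j))\<^sup>2 / real (j + 1)))" for j
    by (simp only: of_real_mult of_real_divide of_real_of_nat_eq complex_norm_square mult.assoc)
  with s have s: "(\<lambda>j. complex_of_real (pi * (q j * (cmod (c j))\<^sup>2 / real (j + 1))))
      sums L2_inner (self_commutator T u) u" by (simp only:)
  have "0 \<le> Re (complex_of_real (pi * (q j * (cmod (c j))\<^sup>2 / real (j + 1))))" for j
    unfolding Re_complex_of_real using q [of j]
    by (intro mult_nonneg_nonneg divide_nonneg_nonneg) auto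
  then have "0 \<le> Re (L2_inner (self_commutator T u) u)"
    by (rule sums_le [OF _ sums_zero sums_Re [OF s]])
  moreover have "Im (L2_inner (self_commutator T u) u) = 0"
    by (rule sums_unique2 [OF sums_Im [OF s, unfolded Im_complex_of_real] sums_zero])
  ultimately show "L2_inner (self_commutator T u) u \<in> \<real>\<^sub>\<ge>\<^sub>0"
    by (simp add: complex_nonneg_Reals_iff)
qed

section \<open>Toeplitz operators with quasihomogeneous symbols\<close>

lemma bergman_proj_eqI:
  assumes h: "h \<in> bergman_space"
    and int: "\<And>u. u \<in> bergman_space \<Longrightarrow> integrable disc_measure (\<lambda>z. g z * cnj (u z))"
    and eq: "\<And>u. u \<in> bergman_space \<Longrightarrow> L2_inner g u = L2_inner h u"
  shows "bergman_proj g = h"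
proof -
  have diff: "L2_inner (\<lambda>z. g z - f z) u = L2_inner g u - L2_inner f u"
    if "f \<in> bergman_space" "u \<in> bergman_space" for f u
  proof -
    have "integrable disc_measure (\<lambda>z. f z * cnj (u z))"
      using that bergman_series_inner(1) by (auto simp: bergman_space_iff_series)
    then show ?thesis
      using int [OF that(2)] by (simp add: L2_inner_def left_diff_distrib)
  qed
  show ?thesis
    unfolding bergman_proj_def
  proof (rule the_equality)
    show "h \<in> bergman_space \<and> (\<forall>u\<in>bergman_space. L2_inner (\<lambda>z. g z - h z) u = 0)"
      using h eq diff by simp
    fix h' assume h': "h' \<in> bergman_space \<and> (\<forall>u\<in>bergman_space. L2_inner (\<lambda>z. g z - h' z) u = 0)"
    show "h' = h"
    proof (rule bergman_space_eqI)
      fix u assume u: "u \<in> bergman_space"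
      then have "L2_inner h' u = L2_inner h u"
        using h' eq [OF u] diff [of h' u] by simp
      then show "L2_inner u h' = L2_inner u h"
        by (simp add: L2_inner_commute [of u])
    qed (use h h' in auto)
  qed
qed

text \<open>The coefficients of \<open>P(\<phi> f)\<close> are found by pairing with an arbitrary \<open>u\<close>: moving the conjugate factor,
  \<open>\<langle>z\<^sup>m cnj z\<^sup>n f, u\<rangle> = \<langle>z\<^sup>m f, z\<^sup>n u\<rangle>\<close>, and both entries of the latter are members of the Bergman space,
  so Parseval's identity evaluates it. As \<open>m - n = \<delta>\<close> for every monomial of \<open>\<phi>\<close>, the coefficient \<open>c\<^sub>j\<close>
  always meets the coefficient of \<open>u\<close> with index \<open>j + \<delta>\<close>.\<close>

lemma toeplitz_weighted_shift:
  fixes k \<delta> :: nat and m n :: "nat \<Rightarrow> nat" and a :: "nat \<Rightarrow> complex"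
  defines "\<phi> \<equiv> \<lambda>z. \<Sum>i=1..k. a i * z ^ m i * cnj z ^ n i"
    and "w \<equiv> \<lambda>j. \<Sum>i=1..k. a i * of_real (real (j + \<delta> + 1) / real (j + m i + 1))"
  assumes mn: "\<And>i. i \<in> {1..k} \<Longrightarrow> m i = n i + \<delta>" and f: "bergman_series f c"
    and w: "\<And>j. cmod (w j) \<le> W"
  shows "bergman_series (toeplitz \<phi> f) (\<lambda>j. if j < \<delta> then 0 else w (j - \<delta>) * c (j - \<delta>))"
proof -
  have "summable (\<lambda>j. (cmod (c j))\<^sup>2 / (j + 1))"
    using f by (simp add: bergman_series_def)
  from bergman_series_exists [OF summable_weighted_shift(1) [OF this w, of \<delta>]]
  obtain h where h: "bergman_series h (\<lambda>j. if j < \<delta> then 0 else w (j - \<delta>) * c (j - \<delta>))" ..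
  have split: "\<phi> z * f z * cnj (u z)
      = (\<Sum>i=1..k. a i * ((z ^ m i * f z) * cnj (z ^ n i * u z)))" for u z
    by (simp add: \<phi>_def sum_distrib_left sum_distrib_right mult_ac)
  have pair: "integrable disc_measure (\<lambda>z. (z ^ m i * f z) * cnj (z ^ n i * u z))"
    if "bergman_series u d" for u d i
    by (rule bergman_series_inner(1) [OF bergman_series_power_mult [OF f] bergman_series_power_mult [OF that]])
  have "bergman_proj (\<lambda>z. \<phi> z * f z) = h"
  proof (rule bergman_proj_eqI)
    show "h \<in> bergman_space" using h by (auto simp: bergman_space_iff_series)
    fix u assume "u \<in> bergman_space"
    then obtain d where d: "bergman_series u d" by (auto simp: bergman_space_iff_series)
    show "integrable disc_measure (\<lambda>z. \<phi> z * f z * cnj (u z))"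
      unfolding split by (intro Bochner_Integration.integrable_sum integrable_mult_right pair [OF d])
    let ?t = "\<lambda>i j. of_real pi * (c j * cnj (d (j + \<delta>)) / of_nat (j + m i + 1))"
    have mono: "?t i sums L2_inner (\<lambda>z. z ^ m i * f z) (\<lambda>z. z ^ n i * u z)" if i: "i \<in> {1..k}" for i
    proof (rule sums_shifted [where \<delta> = "m i", OF bergman_series_inner(2) [OF bergman_series_power_mult [OF f] bergman_series_power_mult [OF d]]])
      show "of_real pi * ((if j + m i < m i then 0 else c (j + m i - m i))
            * cnj (if j + m i < n i then 0 else d (j + m i - n i)) / of_nat (j + m i + 1)) = ?t i j" for j
        using mn [OF i] by simp
    qed auto
    have "L2_inner (\<lambda>z. \<phi> z * f z) u = (\<Sum>i=1..k. a i * L2_inner (\<lambda>z. z ^ m i * f z) (\<lambda>z. z ^ n i * u z))"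
      unfolding L2_inner_def split
      by (simp only: Bochner_Integration.integral_sum [OF integrable_mult_right [OF pair [OF d]]]
            integral_mult_right_zero)
    moreover have "(\<lambda>j. \<Sum>i=1..k. a i * ?t i j) sums (\<Sum>i=1..k. a i * L2_inner (\<lambda>z. z ^ m i * f z) (\<lambda>z. z ^ n i * u z))"
      by (intro sums_sum sums_mult mono)
    moreover have "(\<lambda>j. \<Sum>i=1..k. a i * ?t i j) sums L2_inner h u"
    proof (rule sums_shifted [where \<delta> = "\<delta>", OF bergman_series_inner(2) [OF h d]])
      fix j
      have "w j / of_nat (j + \<delta> + 1) = (\<Sum>i=1..k. a i / of_nat (j + m i + 1))"
        unfolding w_def sum_divide_distrib
        by (intro sum.cong refl) (simp add: of_nat_neq_0 del: of_nat_Suc of_nat_add)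
      moreover have "(\<Sum>i=1..k. a i * ?t i j)
          = of_real pi * (c j * cnj (d (j + \<delta>))) * (\<Sum>i=1..k. a i / of_nat (j + m i + 1))"
        unfolding sum_distrib_left by (intro sum.cong refl) simp
      ultimately have "(\<Sum>i=1..k. a i * ?t i j)
          = of_real pi * (c j * cnj (d (j + \<delta>))) * (w j / of_nat (j + \<delta> + 1))"
        by simp
      then show "of_real pi * ((if j + \<delta> < \<delta> then 0 else w (j + \<delta> - \<delta>) * c (j + \<delta> - \<delta>)) * cnj (d (j + \<delta>)) / of_nat (j + \<delta> + 1))
          = (\<Sum>i=1..k. a i * ?t i j)"
        by (simp add: mult_ac)
    qed auto
    ultimately show "L2_inner (\<lambda>z. \<phi> z * f z) u = L2_inner h u"
      by (metis (no_types, lifting) sums_unique2)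
  qed
  then show ?thesis using h by (simp add: toeplitz_def)
qed

lemma cmod_sum_real_weights:
  fixes a :: "'i \<Rightarrow> complex" and x :: "'i \<Rightarrow> real"
  shows "(cmod (\<Sum>i\<in>A. a i * of_real (x i)))\<^sup>2 = (\<Sum>i\<in>A. \<Sum>l\<in>A. Re (a i * cnj (a l)) * (x i * x l))"
proof -
  have "(cmod (\<Sum>i\<in>A. a i * of_real (x i)))\<^sup>2
      = Re ((\<Sum>i\<in>A. a i * of_real (x i)) * cnj (\<Sum>i\<in>A. a i * of_real (x i)))"
    by (simp only: complex_norm_square [symmetric] Re_complex_of_real)
  also have "\<dots> = (\<Sum>i\<in>A. \<Sum>l\<in>A. Re ((a i * of_real (x i)) * cnj (a l * of_real (x l))))"
    by (simp only: cnj_sum sum_product Re_sum)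
  also have "\<dots> = (\<Sum>i\<in>A. \<Sum>l\<in>A. Re (a i * cnj (a l)) * (x i * x l))"
    by (intro sum.cong refl) (simp add: algebra_simps)
  finally show ?thesis .
qed

text \<open>The angle between two numbers in a common quarter-plane is at most a right angle.\<close>

lemma Re_mult_cnj_nonneg:
  assumes "\<theta>\<^sub>0 \<le> \<theta>" "\<theta> \<le> \<theta>\<^sub>0 + pi / 2" "a = of_real (cmod a) * exp (\<i> * of_real \<theta>)"
    and "\<theta>\<^sub>0 \<le> \<theta>'" "\<theta>' \<le> \<theta>\<^sub>0 + pi / 2" "b = of_real (cmod b) * exp (\<i> * of_real \<theta>')"
  shows "0 \<le> Re (a * cnj b)"
proof -
  have "a = of_real (cmod a) * cis \<theta>" "b = of_real (cmod b) * cis \<theta>'"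
    using assms by (simp_all add: cis_conv_exp)
  then have "a * cnj b = of_real (cmod a * cmod b) * (cis \<theta> * cis (- \<theta>'))"
    by (metis (no_types, lifting) cis_cnj complex_cnj_complex_of_real complex_cnj_mult mult.assoc
        mult.left_commute of_real_mult)
  also have "\<dots> = of_real (cmod a * cmod b) * cis (\<theta> - \<theta>')"
    by (simp add: cis_mult)
  finally have "Re (a * cnj b) = cmod a * cmod b * cos (\<theta> - \<theta>')"
    by simp
  moreover have "0 \<le> cos (\<theta> - \<theta>')"
    using assms by (intro cos_ge_zero) auto
  ultimately show ?thesis by simp
qed

lemma frac_shift_mono:
  fixes b c x y :: real
  assumes "0 < b" "b \<le> c" "0 \<le> x" "x \<le> y"
  shows "(x + b) / (x + c) \<le> (y + b) / (y + c)"
proof -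
  have "(c - b) * x \<le> (c - b) * y"
    using assms by (intro mult_left_mono) auto
  then show ?thesis
    using assms by (simp add: divide_simps) (simp add: algebra_simps)
qed

theorem theorem13:
  fixes k \<delta> :: nat and m n :: "nat \<Rightarrow> nat" and a :: "nat \<Rightarrow> complex"
  assumes "k \<ge> 1"
    and "\<And>i. i \<in> {1..k} \<Longrightarrow> int (m i) - int (n i) = int \<delta>"
    and "\<And>i. i \<in> {1..k} \<Longrightarrow> a i \<noteq> 0"
    and "\<exists>\<theta>\<^sub>0::real. \<forall>i\<in>{1..k}. \<exists>\<theta>::real.
           \<theta>\<^sub>0 \<le> \<theta> \<and> \<theta> \<le> \<theta>\<^sub>0 + pi / 2
         \<and> a i = of_real (cmod (a i)) * exp (\<i> * of_real \<theta>)"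
  shows "hyponormal (toeplitz (\<lambda>z. \<Sum>i=1..k. a i * z ^ m i * cnj z ^ n i))"
proof -
  have mn: "m i = n i + \<delta>" if "i \<in> {1..k}" for i
    using assms(2) [OF that] by linarith
  define w where "w j = (\<Sum>i=1..k. a i * of_real (real (j + \<delta> + 1) / real (j + m i + 1)))" for j :: nat
  have w: "cmod (w j) \<le> (\<Sum>i=1..k. cmod (a i))" for j
    unfolding w_def
  proof (rule sum_norm_le)
    fix i assume "i \<in> {1..k}"
    then have "real (j + \<delta> + 1) / real (j + m i + 1) \<le> 1"
      using mn [of i] by simp
    then have "cmod (a i) * (real (j + \<delta> + 1) / real (j + m i + 1)) \<le> cmod (a i) * 1"
      by (intro mult_left_mono) auto
    then show "cmod (a i * of_real (real (j + \<delta> + 1) / real (j + m i + 1))) \<le> cmod (a i)"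
      by (simp only: norm_mult norm_of_real) simp
  qed
  have quarter: "0 \<le> Re (a i * cnj (a l))" if "i \<in> {1..k}" "l \<in> {1..k}" for i l
    using assms(4) that by (blast intro: Re_mult_cnj_nonneg)
  \<comment> \<open>The factor \<open>(j+\<delta>+1)\<^sup>2 (j+1)/(j+\<delta>+1)\<close> is distributed so that each of the two quotients
    is monotone by itself.\<close>
  let ?p = "\<lambda>x i l. ((x + 1) / (x + (real (m i) + 1))) * ((x + (real \<delta> + 1)) / (x + (real (m l) + 1)))"
  have expand: "(cmod (w j))\<^sup>2 * ((real j + 1) / (real j + real \<delta> + 1))
      = (\<Sum>i=1..k. \<Sum>l=1..k. Re (a i * cnj (a l)) * ?p (real j) i l)" for j
    unfolding w_def cmod_sum_real_weights sum_distrib_right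
    by (intro sum.cong refl) (simp add: divide_simps add_ac)
  have mono: "(cmod (w j))\<^sup>2 * ((real j + 1) / (real j + real \<delta> + 1))
      \<le> (cmod (w (j + \<delta>)))\<^sup>2 * ((real (j + \<delta>) + 1) / (real (j + \<delta>) + real \<delta> + 1))" for j
    unfolding expand
  proof (intro sum_mono mult_left_mono mult_mono frac_shift_mono quarter)
    fix l assume "l \<in> {1..k}"
    then show "real \<delta> + 1 \<le> real (m l) + 1" using mn [of l] by simp
  qed auto
  show ?thesis
  proof (rule hyponormal_weighted_shift)
    show "bergman_series (toeplitz (\<lambda>z. \<Sum>i=1..k. a i * z ^ m i * cnj z ^ n i) f)
        (\<lambda>j. if j < \<delta> then 0 else w (j - \<delta>) * c (j - \<delta>))" if "bergman_series f c" for f c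
      unfolding w_def by (rule toeplitz_weighted_shift [OF mn that w [unfolded w_def]])
    show "(cmod (w j))\<^sup>2 * (real (j + 1) / real (j + \<delta> + 1))
        \<le> (cmod (w (j + \<delta>)))\<^sup>2 * (real (j + \<delta> + 1) / real (j + \<delta> + \<delta> + 1))" for j
      using mono [of j] by (simp add: add_ac)
  qed (rule w)
qed

end
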